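(* Let $k\ge 1$ and $n\ge1$ be integers and let $\epsilon\in(0,1/2)$. (a) If a protocol $(f_1,\dots,f_k)$, $f_i\in\mathcal{B}_n$, maximizes $\mathcal{P}(f_1,\dots,f_k;\epsilon)$ among all protocols, then $f_1=\dots=f_k=f$ for some $f$ which is left-monotone up to $\pi_S$; that is, there are $S\subseteq[n]$ and a permutation $\pi$ of $[n]$ such that $f\circ\pi_S$ is left-monotone. (b) If an antisymmetric protocol $(f_1,\dots,f_k)$, $f_i\in\mathcal{A}_n$, maximizes $\mathcal{P}(f_1,\dots,f_k;\epsilon)$ among all antisymmetric protocols, then $f_1=\dots=f_k=f$ for some $f$ which is left-monotone up to $\pi_S$ (in the same sense).
   Context: Model: $x$ is uniform in $\{0,1\}^n$; $y^1,\dots,y^k \in \{0,1\}^n$ are random strings such that, given $x$, the events $\{y^i_j = x_j\}$ ($1\le i\le k$, $1\le j\le n$) are mutually independent, each of probability $1-\epsilon$. Define $\mathcal{P}(f_1,\dots,f_k;\epsilon) = \mathbf{P}[f_1(y^1)=\dots=f_k(y^k)]$. $\mathcal{B}_n$ is the set of balanced functions $f:\{0,1\}^n\to\{0,1\}$, i.e. $|f^{-1}(0)| = |f^{-1}(1)|$. $\mathcal{A}_n\subset\mathcal{B}_n$ is the set of antisymmetric functions, i.e. those with $f(\bar x)=1-f(x)$ for all $x$, where $\bar x_i=1-x_i$. A protocol is a tuple $(f_1,\dots,f_k)$ of functions in $\mathcal{B}_n$; an antisymmetric protocol is a tuple of functions in $\mathcal{A}_n$. For $x,y\in\{0,1\}^n$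 write $x\preceq_L y$ if $\sum_{i=1}^m x_i\le\sum_{i=1}^m y_i$ for every $m=1,\dots,n$. A function $f$ is left-monotone if $f(x)\le f(y)$ whenever $x\preceq_L y$. For $S\subseteq[n]$ and a permutation $\pi$ of $[n]$, $\pi_S:\{0,1\}^n\to\{0,1\}^n$ is defined by $\pi_S(x)_i = x_{\pi(i)}$ if $i\in S$ and $\pi_S(x)_i = 1-x_{\pi(i)}$ if $i\notin S$.
   Formalization: The formal theorem assumes k ≥ 2 instead of k ≥ 1: for k = 1 the probability is always 1, so every protocol is a maximizer, and parity (n = 2 in (a), n = 3 in (b)) is not left-monotone up to any π_S. *)

theory Defs
  imports "HOL-Probability.Probability" "HOL-Combinatorics.Permutations"
begin

text \<open>
  Bit strings are indexed by \<open>{1..n}\<close>, with \<open>False\<close>, \<open>True\<close> for \<open>0\<close>, \<open>1\<close>. Strings, functions on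
  strings and tuples of functions are all extensional (\<open>undefined\<close> off their domain), so that
  HOL equality is the intended equality of functions with that domain.
\<close>

definition cube :: "nat \<Rightarrow> (nat \<Rightarrow> bool) set" where
  "cube n = {1..n} \<rightarrow>\<^sub>E UNIV"

definition complement_string :: "nat \<Rightarrow> (nat \<Rightarrow> bool) \<Rightarrow> nat \<Rightarrow> bool" where
  "complement_string n x = (\<lambda>i\<in>{1..n}. \<not> x i)"

definition balanced_functions :: "nat \<Rightarrow> ((nat \<Rightarrow> bool) \<Rightarrow> bool) set" where
  "balanced_functions n =
     {f \<in> cube n \<rightarrow>\<^sub>E UNIV. card {x \<in> cube n. f x = False} = card {x \<in> cube n. f x = True}}"

definition antisymmetric_functions :: "nat \<Rightarrow> ((nat \<Rightarrow> bool) \<Rightarrow> bool) set" where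
  "antisymmetric_functions n =
     {f \<in> balanced_functions n. \<forall>x \<in> cube n. f (complement_string n x) = (\<not> f x)}"

definition protocols :: "nat \<Rightarrow> nat \<Rightarrow> (nat \<Rightarrow> (nat \<Rightarrow> bool) \<Rightarrow> bool) set" where
  "protocols n k = {1..k} \<rightarrow>\<^sub>E balanced_functions n"

definition antisymmetric_protocols :: "nat \<Rightarrow> nat \<Rightarrow> (nat \<Rightarrow> (nat \<Rightarrow> bool) \<Rightarrow> bool) set" where
  "antisymmetric_protocols n k = {1..k} \<rightarrow>\<^sub>E antisymmetric_functions n"

text \<open>
  The law of \<open>(y\<^sup>1, \<dots>, y\<^sup>k)\<close>; the bit \<open>c\<close> is the indicator of the event that \<open>y i j = x j\<close>.
\<close>

definition noisy_copies :: "nat \<Rightarrow> nat \<Rightarrow> real \<Rightarrow> (nat \<Rightarrow> nat \<Rightarrow> bool) pmf" where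
  "noisy_copies n k \<epsilon> =
     bind_pmf (pmf_of_set (cube n)) (\<lambda>x.
       Pi_pmf {1..k} undefined (\<lambda>i.
         Pi_pmf {1..n} undefined (\<lambda>j.
           map_pmf (\<lambda>c. if c then x j else \<not> x j) (bernoulli_pmf (1 - \<epsilon>)))))"

definition agreement_prob ::
  "nat \<Rightarrow> nat \<Rightarrow> real \<Rightarrow> (nat \<Rightarrow> (nat \<Rightarrow> bool) \<Rightarrow> bool) \<Rightarrow> real" where
  "agreement_prob n k \<epsilon> f =
     measure_pmf.prob (noisy_copies n k \<epsilon>)
       {y. \<forall>i \<in> {1..k}. \<forall>i' \<in> {1..k}. f i (y i) = f i' (y i')}"

definition left_le :: "nat \<Rightarrow> (nat \<Rightarrow> bool) \<Rightarrow> (nat \<Rightarrow> bool) \<Rightarrow> bool" where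
  "left_le n x y \<longleftrightarrow>
     (\<forall>m \<in> {1..n}. (\<Sum>i=1..m. of_bool (x i) :: nat) \<le> (\<Sum>i=1..m. of_bool (y i)))"

definition left_monotone :: "nat \<Rightarrow> ((nat \<Rightarrow> bool) \<Rightarrow> bool) \<Rightarrow> bool" where
  "left_monotone n f \<longleftrightarrow> (\<forall>x \<in> cube n. \<forall>y \<in> cube n. left_le n x y \<longrightarrow> f x \<le> f y)"

definition perm_flip :: "nat \<Rightarrow> (nat \<Rightarrow> nat) \<Rightarrow> nat set \<Rightarrow> (nat \<Rightarrow> bool) \<Rightarrow> nat \<Rightarrow> bool" where
  "perm_flip n \<pi> S x = (\<lambda>i\<in>{1..n}. if i \<in> S then x (\<pi> i) else \<not> x (\<pi> i))"

definition left_monotone_up_to_perm_flip :: "nat \<Rightarrow> ((nat \<Rightarrow> bool) \<Rightarrow> bool) \<Rightarrow> bool" where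
  "left_monotone_up_to_perm_flip n f \<longleftrightarrow>
     (\<exists>S \<pi>. S \<subseteq> {1..n} \<and> \<pi> permutes {1..n} \<and> left_monotone n (f \<circ> perm_flip n \<pi> S))"

text \<open>
  For \<open>k = 1\<close> the agreement probability is constantly \<open>1\<close>, so every balanced function is a
  maximizer, and parity on two bits is not left-monotone up to any permutation and flips.
  Optimality is therefore informative only for \<open>k \<ge> 2\<close>.
\<close>

lemma one_party_counterexample:
  "\<exists>f. is_arg_max (agreement_prob 2 1 \<epsilon>) (\<lambda>f. f \<in> protocols 2 1) f
       \<and> \<not> left_monotone_up_to_perm_flip 2 (f 1)"
proof -
  define p where "p = (\<lambda>x\<in>cube 2. x 1 \<noteq> x (2::nat))"
  define h where "h x = x(1 := \<not> x 1)" for x :: "nat \<Rightarrow> bool"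
  have h_cube: "h x \<in> cube 2" if "x \<in> cube 2" for x
    using that unfolding cube_def PiE_iff extensional_def h_def by simp
  have h_h: "h (h x) = x" for x
    by (simp add: h_def)
  have p_h: "p (h x) = (\<not> p x)" if "x \<in> cube 2" for x
    using that h_cube[OF that] by (simp add: p_def) (simp add: h_def)
  have "bij_betw h {x \<in> cube 2. p x = False} {x \<in> cube 2. p x = True}"
    by (rule bij_betwI[where g = h]) (simp_all add: h_cube h_h p_h)
  then have "card {x \<in> cube 2. p x = False} = card {x \<in> cube 2. p x = True}"
    by (rule bij_betw_same_card)
  moreover have "p \<in> cube 2 \<rightarrow>\<^sub>E UNIV" by (simp add: p_def)
  ultimately have bal: "p \<in> balanced_functions 2"
    unfolding balanced_functions_def by blast
  define f where "f = (\<lambda>i\<in>{1..1::nat}. p)"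
  have f1: "f 1 = p" by (simp add: f_def)
  have "f \<in> protocols 2 1" using bal by (auto simp: protocols_def f_def)
  then have "is_arg_max (agreement_prob 2 1 \<epsilon>) (\<lambda>f. f \<in> protocols 2 1) f"
    by (simp add: is_arg_max_def agreement_prob_def)
  moreover have "\<not> left_monotone 2 (p \<circ> perm_flip 2 \<pi> S)" if "\<pi> permutes {1..2}" for \<pi> S
  proof
    assume mono: "left_monotone 2 (p \<circ> perm_flip 2 \<pi> S)"
    define a b c :: "nat \<Rightarrow> bool" where "a = (\<lambda>i\<in>{1..2}. False)"
      and "b = (\<lambda>i\<in>{1..2}. i = 1)" and "c = (\<lambda>i\<in>{1..2}. True)"
    have I: "{1..2::nat} = {1, 2}" by auto
    have in_cube: "a \<in> cube 2" "b \<in> cube 2" "c \<in> cube 2"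
      by (auto simp: cube_def a_def b_def c_def)
    have "left_le 2 a b" "left_le 2 b c"
      by (auto simp: left_le_def a_def b_def c_def I intro!: sum_mono)
    with mono in_cube have le: "p (perm_flip 2 \<pi> S a) \<le> p (perm_flip 2 \<pi> S b)"
      "p (perm_flip 2 \<pi> S b) \<le> p (perm_flip 2 \<pi> S c)"
      unfolding left_monotone_def by auto
    have pf: "perm_flip 2 \<pi> S x \<in> cube 2" for x
      by (auto simp: perm_flip_def cube_def)
    have "\<pi> 1 \<in> {1..2}" "\<pi> 2 \<in> {1..2}"
      using permutes_in_image[OF that, of 1] permutes_in_image[OF that, of 2] by simp_all
    moreover have "\<pi> 1 \<noteq> \<pi> 2"
      using inj_eq[OF permutes_inj[OF that], of 1 2] by simp
    ultimately have "\<pi> 1 = 1 \<and> \<pi> 2 = 2 \<or> \<pi> 1 = 2 \<and> \<pi> 2 = 1" by (auto simp: I)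
    moreover have "p (perm_flip 2 \<pi> S x) \<longleftrightarrow>
        (x (\<pi> 1) \<longleftrightarrow> x (\<pi> 2)) = ((1 \<in> S) \<noteq> (2 \<in> S))" for x
    proof -
      have "p (perm_flip 2 \<pi> S x) \<longleftrightarrow> perm_flip 2 \<pi> S x 1 \<noteq> perm_flip 2 \<pi> S x 2"
        using pf by (simp add: p_def)
      then show ?thesis by (simp add: perm_flip_def)
    qed
    moreover have "a 1 = False" "a 2 = False" "b 1 = True" "b 2 = False" "c 1 = True" "c 2 = True"
      by (simp_all add: a_def b_def c_def)
    ultimately show False using le by (elim disjE conjE) simp_all
  qed
  ultimately show ?thesis
    using f1 by (auto simp: left_monotone_up_to_perm_flip_def)
qed

end

theory Submission
  imports Defs
begin

text \<open>
  With \<open>T\<close> the noise operator, the agreement probability is the mean over \<open>x\<close> of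
  \<open>\<Prod>i. T f\<^sub>i x\<close> plus \<open>\<Prod>i. (1 - T f\<^sub>i x)\<close>. If \<open>f\<^sub>i \<noteq> f\<^sub>j\<close>, then \<open>T f\<^sub>i \<noteq> T f\<^sub>j\<close>, and giving both
  players \<open>f\<^sub>i\<close> or giving both \<open>f\<^sub>j\<close> is a strict improvement; so all players of an optimal
  protocol use one function \<open>f\<close>, which maximizes the mean of \<open>\<phi> (T f)\<close> for the strictly convex
  \<open>\<phi> t = t ^ k + (1 - t) ^ k\<close>.

  Let \<open>\<sigma>\<close> flip one coordinate or exchange two. Sorting the values of \<open>f\<close> on each pair
  \<open>{x, \<sigma> x}\<close> in a consistent direction (polarization) preserves balancedness and antisymmetry,
  keeps \<open>T f x + T f (\<sigma> x)\<close> and does not decrease \<open>\<bar>T f x - T f (\<sigma> x)\<bar>\<close>, so it increases the mean of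
  \<open>\<phi> (T f)\<close> strictly unless all pairs were already sorted in the same direction. Flips thus
  yield a direction of monotonicity for each coordinate, and exchanges a comparison of any two
  coordinates. This comparison is a total preorder, and sorting the coordinates by it makes \<open>f\<close>
  left-monotone.
\<close>

section \<open>Bit strings\<close>

lemma finite_cube [simp]: "finite (cube n)"
  by (simp add: cube_def finite_PiE)

lemma cube_nonempty [simp]: "cube n \<noteq> {}"
  by (simp add: cube_def PiE_eq_empty_iff)

lemma cube_eqI: "x \<in> cube n \<Longrightarrow> y \<in> cube n \<Longrightarrow> (\<And>j. j \<in> {1..n} \<Longrightarrow> x j = y j) \<Longrightarrow> x = y"
  unfolding cube_def by (rule PiE_ext)

lemma fun_upd_in_cube [simp]: "x \<in> cube n \<Longrightarrow> i \<in> {1..n} \<Longrightarrow> x(i := b) \<in> cube n"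
  by (auto simp: cube_def PiE_iff extensional_def)

lemma complement_string_in_cube [simp]: "complement_string n x \<in> cube n"
  by (auto simp: cube_def complement_string_def)

lemma complement_string_apply [simp]:
  "i \<in> {1..n} \<Longrightarrow> complement_string n x i \<longleftrightarrow> \<not> x i"
  by (simp add: complement_string_def)

section \<open>The noise operator\<close>

definition noise_kernel :: "nat \<Rightarrow> real \<Rightarrow> (nat \<Rightarrow> bool) \<Rightarrow> (nat \<Rightarrow> bool) \<Rightarrow> real" where
  "noise_kernel n \<epsilon> x y = (\<Prod>j\<in>{1..n}. if y j = x j then 1 - \<epsilon> else \<epsilon>)"

text \<open>The conditional probability, given \<open>x\<close>, that \<open>f\<close> is true on a
  noisy copy of \<open>x\<close>. As an operator on functions it is the Bonami-Beckner operator with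
  correlation \<open>1 - 2 * \<epsilon>\<close>.\<close>

definition noise :: "nat \<Rightarrow> real \<Rightarrow> ((nat \<Rightarrow> bool) \<Rightarrow> bool) \<Rightarrow> (nat \<Rightarrow> bool) \<Rightarrow> real" where
  "noise n \<epsilon> f x = (\<Sum>y\<in>cube n. noise_kernel n \<epsilon> x y * of_bool (f y))"

lemma noise_kernel_pos: "0 < \<epsilon> \<Longrightarrow> \<epsilon> < 1 \<Longrightarrow> 0 < noise_kernel n \<epsilon> x y"
  unfolding noise_kernel_def by (intro prod_pos) auto

text \<open>Distributivity: expanding the product on the right chooses one bit per coordinate. This
  reduces sums of tensor products over the cube to single-bit computations.\<close>

lemma sum_cube_prod:
  fixes h :: "nat \<Rightarrow> bool \<Rightarrow> real"
  shows "(\<Sum>z\<in>cube n. \<Prod>j\<in>{1..n}. h j (z j)) = (\<Prod>j\<in>{1..n}. h j False + h j True)"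
  by (simp add: cube_def prod_sum_PiE [symmetric] UNIV_bool)

lemma sum_noise_kernel: "(\<Sum>y\<in>cube n. noise_kernel n \<epsilon> x y) = 1"
proof -
  have "(\<Sum>y\<in>cube n. noise_kernel n \<epsilon> x y)
      = (\<Prod>j\<in>{1..n}. (if False = x j then 1 - \<epsilon> else \<epsilon>) + (if True = x j then 1 - \<epsilon> else \<epsilon>))"
    unfolding noise_kernel_def by (rule sum_cube_prod[of "\<lambda>j b. if b = x j then 1 - \<epsilon> else \<epsilon>"])
  also have "\<dots> = 1" by (rule prod.neutral) auto
  finally show ?thesis .
qed

lemma noise_complement: "noise n \<epsilon> (\<lambda>y. \<not> f y) x = 1 - noise n \<epsilon> f x"
proof -
  have "noise n \<epsilon> (\<lambda>y. \<not> f y) x + noise n \<epsilon> f x = (\<Sum>y\<in>cube n. noise_kernel n \<epsilon> x y)"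
    unfolding noise_def sum.distrib [symmetric] by (rule sum.cong) auto
  then show ?thesis by (simp add: sum_noise_kernel)
qed

lemma noise_nonneg: "0 < \<epsilon> \<Longrightarrow> \<epsilon> < 1 \<Longrightarrow> 0 \<le> noise n \<epsilon> f x"
  unfolding noise_def by (intro sum_nonneg mult_nonneg_nonneg) (auto intro: less_imp_le noise_kernel_pos)

lemma noise_le_1: "0 < \<epsilon> \<Longrightarrow> \<epsilon> < 1 \<Longrightarrow> noise n \<epsilon> f x \<le> 1"
  using noise_nonneg[of \<epsilon> n "\<lambda>y. \<not> f y" x] by (simp add: noise_complement)

lemma noise_pos:
  assumes "0 < \<epsilon>" "\<epsilon> < 1" "y \<in> cube n" "f y"
  shows "0 < noise n \<epsilon> f x"
  unfolding noise_def
  by (rule sum_pos2[where i = y])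
     (use assms in \<open>auto intro!: noise_kernel_pos intro: less_imp_le[OF noise_kernel_pos]\<close>)

lemma noise_less_1:
  assumes "0 < \<epsilon>" "\<epsilon> < 1" "y \<in> cube n" "\<not> f y"
  shows "noise n \<epsilon> f x < 1"
  using noise_pos[of \<epsilon> y n "\<lambda>y. \<not> f y" x] assms by (simp add: noise_complement)

text \<open>
  The kernel is a tensor power of a \<open>2 \<times> 2\<close> matrix of determinant \<open>1 - 2 \<epsilon>\<close>; up to that scalar
  the inverse of the matrix is obtained by changing the sign of the off-diagonal entries.
\<close>

lemma noise_inj:
  assumes "\<epsilon> \<noteq> 1/2" and eq: "\<And>x. x \<in> cube n \<Longrightarrow> noise n \<epsilon> f x = noise n \<epsilon> g x" and x: "x \<in> cube n"
  shows "f x = g x"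
proof -
  \<comment> \<open>Row \<open>x\<close> of the inverse kernel matrix, up to the scalar
    \<open>(1 - 2 * \<epsilon>) ^ n\<close>.\<close>
  define L where "L z = (\<Prod>j\<in>{1..n}. if z j = x j then 1 - \<epsilon> else - \<epsilon>)" for z :: "nat \<Rightarrow> bool"
  have LK: "(\<Sum>z\<in>cube n. L z * noise_kernel n \<epsilon> z y) = (1 - 2 * \<epsilon>) ^ n * of_bool (x = y)"
    if y: "y \<in> cube n" for y
  proof -
    define h where
      "h j b = (if b = x j then 1 - \<epsilon> else - \<epsilon>) * (if y j = b then 1 - \<epsilon> else \<epsilon>)" for j b
    have "(\<Sum>z\<in>cube n. L z * noise_kernel n \<epsilon> z y) = (\<Sum>z\<in>cube n. \<Prod>j\<in>{1..n}. h j (z j))"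
      unfolding L_def noise_kernel_def h_def prod.distrib ..
    also have "\<dots> = (\<Prod>j\<in>{1..n}. h j False + h j True)" by (rule sum_cube_prod)
    \<comment> \<open>The two bits contribute \<open>(1 - \<epsilon>)^2 - \<epsilon>^2\<close> where
      \<open>x\<close> and \<open>y\<close> agree, and two cancelling products
      \<open>\<epsilon> * (1 - \<epsilon>)\<close> where they differ.\<close>
    also have "\<dots> = (\<Prod>j\<in>{1..n}. if x j = y j then 1 - 2 * \<epsilon> else 0)"
      by (rule prod.cong) (auto simp: h_def algebra_simps)
    also have "\<dots> = (1 - 2 * \<epsilon>) ^ n * of_bool (x = y)"
    proof (cases "x = y")
      case False
      then obtain j where "j \<in> {1..n}" "x j \<noteq> y j" using cube_eqI[OF x y] by blast
      then have "(\<Prod>j\<in>{1..n}. if x j = y j then 1 - 2 * \<epsilon> else 0) = 0"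
        by (intro prod_zero) auto
      then show ?thesis using False by simp
    qed simp
    finally show ?thesis .
  qed
  have inv: "(\<Sum>z\<in>cube n. L z * noise n \<epsilon> F z) = (1 - 2 * \<epsilon>) ^ n * of_bool (F x)" for F
  proof -
    have "(\<Sum>z\<in>cube n. L z * noise n \<epsilon> F z)
        = (\<Sum>z\<in>cube n. \<Sum>y\<in>cube n. L z * noise_kernel n \<epsilon> z y * of_bool (F y))"
      unfolding noise_def sum_distrib_left mult.assoc ..
    also have "\<dots> = (\<Sum>y\<in>cube n. \<Sum>z\<in>cube n. L z * noise_kernel n \<epsilon> z y * of_bool (F y))"
      by (rule sum.swap)
    also have "\<dots> = (\<Sum>y\<in>cube n. (1 - 2 * \<epsilon>) ^ n * of_bool (x = y) * of_bool (F y))"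
      unfolding sum_distrib_right [symmetric] by (rule sum.cong) (simp_all only: LK)
    also have "\<dots> = (\<Sum>y\<in>cube n. if y = x then (1 - 2 * \<epsilon>) ^ n * of_bool (F x) else 0)"
      by (rule sum.cong) auto
    also have "\<dots> = (1 - 2 * \<epsilon>) ^ n * of_bool (F x)" using x by simp
    finally show ?thesis .
  qed
  have "(1 - 2 * \<epsilon>) ^ n * of_bool (f x) = (1 - 2 * \<epsilon>) ^ n * of_bool (g x)"
    unfolding inv [symmetric] by (rule sum.cong) (simp_all add: eq)
  moreover have "(1 - 2 * \<epsilon>) ^ n \<noteq> 0" using assms(1) by simp
  ultimately show ?thesis by (auto simp: of_bool_def split: if_splits)
qed

section \<open>The agreement probability in terms of the noise operator\<close>

definition noisy_copy :: "nat \<Rightarrow> real \<Rightarrow> (nat \<Rightarrow> bool) \<Rightarrow> (nat \<Rightarrow> bool) pmf" where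
  "noisy_copy n \<epsilon> x = Pi_pmf {1..n} undefined
     (\<lambda>j. map_pmf (\<lambda>c. if c then x j else \<not> x j) (bernoulli_pmf (1 - \<epsilon>)))"

lemma prob_noisy_copy:
  assumes "0 < \<epsilon>" "\<epsilon> < 1"
  shows "measure_pmf.prob (noisy_copy n \<epsilon> x) {y. f y} = noise n \<epsilon> f x"
proof -
  let ?p = "\<lambda>j. map_pmf (\<lambda>c. if c then x j else \<not> x j) (bernoulli_pmf (1 - \<epsilon>))"
  have bit: "pmf (?p j) b = (if b = x j then 1 - \<epsilon> else \<epsilon>)" for j b
  proof -
    have "pmf (?p j) b = measure_pmf.prob (bernoulli_pmf (1 - \<epsilon>)) {b = x j}"
      by (subst pmf_map) (rule arg_cong[where f = "measure_pmf.prob _"], auto)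
    then show ?thesis using assms by (simp add: measure_pmf_single)
  qed
  have pmf: "pmf (noisy_copy n \<epsilon> x) y = noise_kernel n \<epsilon> x y" if "y \<in> cube n" for y
    using that unfolding noisy_copy_def noise_kernel_def
    by (subst pmf_Pi') (auto simp: bit cube_def PiE_iff extensional_def)
  \<comment> \<open>The default value \<open>undefined\<close> outside \<open>{1..n}\<close> makes
    every sample extensional, so the law lives on \<open>cube n\<close>.\<close>
  have sub: "set_pmf (noisy_copy n \<epsilon> x) \<subseteq> cube n"
    using set_Pi_pmf_subset[of "{1..n}" undefined ?p, folded noisy_copy_def]
    unfolding cube_def PiE_iff extensional_def by blast
  have "measure_pmf.prob (noisy_copy n \<epsilon> x) {y. f y} =
      measure_pmf.prob (noisy_copy n \<epsilon> x) {y \<in> cube n. f y}"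
    by (rule measure_pmf.finite_measure_eq_AE)
       (use sub in \<open>auto simp: AE_measure_pmf_iff\<close>)
  also have "\<dots> = (\<Sum>y | y \<in> cube n \<and> f y. noise_kernel n \<epsilon> x y)"
    by (simp add: measure_measure_pmf_finite pmf)
  also have "\<dots> = noise n \<epsilon> f x"
    unfolding noise_def by (rule sum.mono_neutral_cong_left) auto
  finally show ?thesis .
qed

lemma prob_bind_pmf_of_set:
  assumes "finite A" "A \<noteq> {}"
  shows "measure_pmf.prob (bind_pmf (pmf_of_set A) p) E
    = (\<Sum>x\<in>A. measure_pmf.prob (p x) E) / real (card A)"
proof -
  have "ennreal (measure_pmf.prob (bind_pmf (pmf_of_set A) p) E)
      = (\<integral>\<^sup>+x. ennreal (measure_pmf.prob (p x) E) \<partial>measure_pmf (pmf_of_set A))"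
    by (simp flip: measure_pmf.emeasure_eq_measure)
  also have "\<dots> = ennreal (\<integral>x. measure_pmf.prob (p x) E \<partial>measure_pmf (pmf_of_set A))"
    by (intro nn_integral_eq_integral measure_pmf.integrable_const_bound[where B = 1]) auto
  finally show ?thesis
    using assms by (simp add: integral_pmf_of_set sum_nonneg)
qed

text \<open>Given \<open>x\<close> the copies are independent. Agreement is the disjoint union of
  the events that all outputs are true and that all are false, and each has a product
  probability.\<close>

lemma agreement_prob_eq:
  assumes "0 < \<epsilon>" "\<epsilon> < 1" "k \<ge> 1"
  shows "agreement_prob n k \<epsilon> f = (\<Sum>x\<in>cube n.
      (\<Prod>i\<in>{1..k}. noise n \<epsilon> (f i) x) + (\<Prod>i\<in>{1..k}. 1 - noise n \<epsilon> (f i) x)) / real (card (cube n))"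
proof -
  have "measure_pmf.prob (Pi_pmf {1..k} undefined (\<lambda>i. noisy_copy n \<epsilon> x))
      {y. \<forall>i \<in> {1..k}. \<forall>i' \<in> {1..k}. f i (y i) = f i' (y i')}
      = (\<Prod>i\<in>{1..k}. noise n \<epsilon> (f i) x) + (\<Prod>i\<in>{1..k}. 1 - noise n \<epsilon> (f i) x)" for x
  proof -
    let ?P = "measure_pmf.prob (Pi_pmf {1..k} undefined (\<lambda>i. noisy_copy n \<epsilon> x))"
      and ?E = "{y. \<forall>i \<in> {1..k}. \<forall>i' \<in> {1..k}. f i (y i) = f i' (y i')}"
    let ?Ones = "Pi {1..k} (\<lambda>i. {y. f i y})" and ?Zeros = "Pi {1..k} (\<lambda>i. {y. \<not> f i y})"
    have "(\<forall>i\<in>I. \<forall>i'\<in>I. Q i = Q i') \<longleftrightarrow> (\<forall>i\<in>I. Q i) \<or> (\<forall>i\<in>I. \<not> Q i)"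
      for I :: "nat set" and Q by metis
    then have "?E = ?Ones \<union> ?Zeros"
      by (simp add: Pi_iff set_eq_iff del: atLeastAtMost_iff)
    \<comment> \<open>Disjointness needs a player: over an empty index set both events hold
      always.\<close>
    moreover have "1 \<in> {1..k}" using \<open>k \<ge> 1\<close> by simp
    then have "?Ones \<inter> ?Zeros = {}" unfolding Pi_iff set_eq_iff by blast
    ultimately have "?P ?E = ?P ?Ones + ?P ?Zeros"
      by (simp add: measure_pmf.finite_measure_Union)
    then show ?thesis
      using assms by (simp add: measure_Pi_pmf_Pi prob_noisy_copy noise_complement)
  qed
  then show ?thesis
    unfolding agreement_prob_def noisy_copies_def noisy_copy_def [symmetric]
    by (simp add: prob_bind_pmf_of_set)
qed

section \<open>Spreading two numbers with a fixed sum\<close>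

text \<open>Convexity of the power function. Both \<open>u ^ k - u' ^ k\<close> and
  \<open>v' ^ k - v ^ k\<close> contain the factor \<open>u - u'\<close>, and the cofactors compare
  term by term.\<close>

lemma power_sum_le_spread:
  fixes u v u' v' :: real
  assumes "0 \<le> u'" "u' \<le> u" "u \<le> v" "u + v = u' + v'"
  shows "u ^ k + v ^ k \<le> u' ^ k + v' ^ k"
    and "u' < u \<Longrightarrow> k \<ge> 2 \<Longrightarrow> u ^ k + v ^ k < u' ^ k + v' ^ k"
proof -
  let ?A = "\<Sum>i<k. u' ^ (k - Suc i) * u ^ i" and ?B = "\<Sum>i<k. v ^ (k - Suc i) * v' ^ i"
  have d: "v' - v = u - u'" using assms by simp
  have ab: "u ^ k - u' ^ k = (u - u') * ?A" "v' ^ k - v ^ k = (u - u') * ?B"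
    by (simp_all add: power_diff_sumr2 d)
  have le: "u' ^ (k - Suc i) * u ^ i \<le> v ^ (k - Suc i) * v' ^ i" for i
    using assms by (intro mult_mono power_mono) auto
  have "(u - u') * ?A \<le> (u - u') * ?B"
    using assms by (intro mult_left_mono sum_mono le) auto
  with ab show "u ^ k + v ^ k \<le> u' ^ k + v' ^ k" by linarith
  assume *: "u' < u" "k \<ge> 2"
  \<comment> \<open>The last summands, where \<open>i = k - 1\<close>, differ strictly:
    \<open>v'\<close> exceeds \<open>v\<close>, hence \<open>u\<close>, and the exponent is positive
    since \<open>k\<close> is at least 2.\<close>
  have "u ^ (k - 1) < v' ^ (k - 1)"
    using assms * by (intro power_strict_mono) auto
  then have "?A < ?B"
    using * by (intro sum_strict_mono_ex1 ballI le bexI[of _ "k - 1"]) auto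
  then have "(u - u') * ?A < (u - u') * ?B" using * by (intro mult_strict_left_mono) auto
  with ab show "u ^ k + v ^ k < u' ^ k + v' ^ k" by linarith
qed

text \<open>Order each pair by \<open>min\<close> and \<open>max\<close>: for equal sums, a larger
  gap means a smaller minimum.\<close>

lemma power_sum_le_spread_abs:
  fixes u v u' v' :: real
  assumes "0 \<le> u'" "0 \<le> v'" "u + v = u' + v'" "\<bar>u - v\<bar> \<le> \<bar>u' - v'\<bar>"
  shows "u ^ k + v ^ k \<le> u' ^ k + v' ^ k"
    and "\<bar>u - v\<bar> < \<bar>u' - v'\<bar> \<Longrightarrow> k \<ge> 2 \<Longrightarrow> u ^ k + v ^ k < u' ^ k + v' ^ k"
proof -
  have eq: "a ^ k + b ^ k = min a b ^ k + max a b ^ k" for a b :: real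
    by (simp add: min_def max_def)
  have "0 \<le> min u' v'" "min u' v' \<le> min u v" "min u v \<le> max u v"
    "min u v + max u v = min u' v' + max u' v'"
    using assms by (auto simp: min_def max_def)
  note spread = power_sum_le_spread[OF this, of k]
  show "u ^ k + v ^ k \<le> u' ^ k + v' ^ k"
    unfolding eq[of u v] eq[of u' v'] by (rule spread)
  assume *: "\<bar>u - v\<bar> < \<bar>u' - v'\<bar>" "k \<ge> 2"
  then have "min u' v' < min u v" using assms by (auto simp: min_def)
  then show "u ^ k + v ^ k < u' ^ k + v' ^ k"
    unfolding eq[of u v] eq[of u' v'] using * by (intro spread)
qed

section \<open>Polarization\<close>

text \<open>
  \<open>H\<close> is one side of the mirror and \<open>\<sigma> ` H\<close> the other; points on neither side are fixed. The
  last assumption says that a point of \<open>H\<close> is closer to \<open>y \<in> H\<close> than to its mirror image.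
\<close>

locale reflection =
  fixes n :: nat and \<epsilon> :: real and \<sigma> :: "(nat \<Rightarrow> bool) \<Rightarrow> nat \<Rightarrow> bool" and H :: "(nat \<Rightarrow> bool) set"
  assumes eps: "0 < \<epsilon>" "\<epsilon> < 1"
    and reflect_cube: "x \<in> cube n \<Longrightarrow> \<sigma> x \<in> cube n"
    and reflect_reflect: "x \<in> cube n \<Longrightarrow> \<sigma> (\<sigma> x) = x"
    and reflect_half: "x \<in> cube n \<Longrightarrow> x \<in> H \<Longrightarrow> \<sigma> x \<notin> H"
    and reflect_fixed: "x \<in> cube n \<Longrightarrow> x \<notin> H \<Longrightarrow> \<sigma> x \<notin> H \<Longrightarrow> \<sigma> x = x"
    and reflect_complement: "x \<in> cube n \<Longrightarrow> \<sigma> (complement_string n x) = complement_string n (\<sigma> x)"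
    and complement_half: "x \<in> cube n \<Longrightarrow> complement_string n x \<in> H \<longleftrightarrow> \<sigma> x \<in> H"
    and kernel_reflect: "x \<in> cube n \<Longrightarrow> y \<in> cube n \<Longrightarrow>
      noise_kernel n \<epsilon> (\<sigma> x) (\<sigma> y) = noise_kernel n \<epsilon> x y"
    and kernel_half: "x \<in> cube n \<Longrightarrow> y \<in> cube n \<Longrightarrow> x \<in> H \<Longrightarrow> y \<in> H \<Longrightarrow>
      noise_kernel n \<epsilon> x (\<sigma> y) < noise_kernel n \<epsilon> x y"
begin

text \<open>The two-point rearrangement: if exactly one point of a pair
  \<open>{x, \<sigma> x}\<close> has the value true, that value goes to the side \<open>H\<close>.
  The restriction to \<open>cube n\<close> keeps the result extensional, as
  \<open>balanced_functions\<close> requires.\<close>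

definition polarize :: "((nat \<Rightarrow> bool) \<Rightarrow> bool) \<Rightarrow> (nat \<Rightarrow> bool) \<Rightarrow> bool" where
  "polarize f = (\<lambda>x\<in>cube n.
     if x \<in> H then f x \<or> f (\<sigma> x) else if \<sigma> x \<in> H then f x \<and> f (\<sigma> x) else f x)"

lemma sum_reflect: "(\<Sum>x\<in>cube n. h (\<sigma> x)) = (\<Sum>x\<in>cube n. h x)"
  by (rule sum.reindex_bij_betw, rule bij_betwI[where g = \<sigma>]) (auto simp: reflect_cube reflect_reflect)

lemma polarize_pair_sum:
  assumes "x \<in> cube n"
  shows "of_bool (polarize f x) + of_bool (polarize f (\<sigma> x)) = (of_bool (f x) + of_bool (f (\<sigma> x)) :: real)"
  using assms reflect_cube[OF assms] reflect_reflect[OF assms] reflect_half[OF assms]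
    reflect_fixed[OF assms]
  by (auto simp: polarize_def)

lemma polarize_half_diff:
  assumes "x \<in> cube n" "x \<in> H"
  shows "of_bool (polarize f x) - of_bool (polarize f (\<sigma> x)) = \<bar>of_bool (f x) - of_bool (f (\<sigma> x)) :: real\<bar>"
  using assms reflect_cube[OF assms(1)] reflect_reflect[OF assms(1)] reflect_half[OF assms]
  by (auto simp: polarize_def)

text \<open>The kernel is invariant under the involution \<open>\<sigma>\<close>, so the noise
  operator commutes with it; substitute \<open>\<sigma> y\<close> for \<open>y\<close>.\<close>

lemma noise_reflect:
  assumes "x \<in> cube n"
  shows "noise n \<epsilon> f (\<sigma> x) = (\<Sum>y\<in>cube n. noise_kernel n \<epsilon> x y * of_bool (f (\<sigma> y)))"
proof -
  have "noise n \<epsilon> f (\<sigma> x) = (\<Sum>y\<in>cube n. noise_kernel n \<epsilon> (\<sigma> x) (\<sigma> y) * of_bool (f (\<sigma> y)))"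
    unfolding noise_def by (rule sum_reflect [symmetric])
  also have "\<dots> = (\<Sum>y\<in>cube n. noise_kernel n \<epsilon> x y * of_bool (f (\<sigma> y)))"
    by (rule sum.cong) (simp_all add: kernel_reflect assms)
  finally show ?thesis .
qed

lemma noise_pair_sum:
  assumes "x \<in> cube n"
  shows "noise n \<epsilon> f x + noise n \<epsilon> f (\<sigma> x)
    = (\<Sum>y\<in>cube n. noise_kernel n \<epsilon> x y * (of_bool (f y) + of_bool (f (\<sigma> y))))"
  unfolding noise_reflect[OF assms] noise_def[of n \<epsilon> f x]
  by (simp add: sum.distrib distrib_left)

lemma noise_polarize_pair_sum:
  assumes "x \<in> cube n"
  shows "noise n \<epsilon> (polarize f) x + noise n \<epsilon> (polarize f) (\<sigma> x)
    = noise n \<epsilon> f x + noise n \<epsilon> f (\<sigma> x)"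
  unfolding noise_pair_sum[OF assms] by (rule sum.cong) (simp_all add: polarize_pair_sum)

text \<open>The difference \<open>D\<close> is odd under \<open>\<sigma>\<close>, so the sum folds
  onto \<open>H\<close>. For \<open>x\<close> in \<open>H\<close> the resulting weights are positive
  by \<open>kernel_half\<close>, which drives both comparisons with \<open>polarize\<close>.\<close>

lemma noise_half_diff:
  assumes x: "x \<in> cube n"
  shows "noise n \<epsilon> f x - noise n \<epsilon> f (\<sigma> x) = (\<Sum>y | y \<in> cube n \<and> y \<in> H.
      (noise_kernel n \<epsilon> x y - noise_kernel n \<epsilon> x (\<sigma> y)) * (of_bool (f y) - of_bool (f (\<sigma> y))))"
proof -
  let ?K = "noise_kernel n \<epsilon> x"
  define D where "D y = (of_bool (f y) - of_bool (f (\<sigma> y)) :: real)" for y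
  have D\<sigma>: "D (\<sigma> y) = - D y" if "y \<in> cube n" for y
    using that by (simp add: D_def reflect_reflect)
  \<comment> \<open>A point lies on exactly one side of the mirror or is fixed, and at fixed points
    \<open>D\<close> vanishes.\<close>
  have D_split: "D y = of_bool (y \<in> H) * D y + of_bool (\<sigma> y \<in> H) * D y" if "y \<in> cube n" for y
    using that reflect_half[of y] reflect_fixed[of y]
    by (cases "y \<in> H"; cases "\<sigma> y \<in> H") (simp_all add: D_def)
  have "noise n \<epsilon> f x - noise n \<epsilon> f (\<sigma> x) = (\<Sum>y\<in>cube n. ?K y * D y)"
    unfolding noise_reflect[OF x] noise_def[of n \<epsilon> f x] D_def
    by (simp add: sum_subtractf right_diff_distrib)
  also have "\<dots> = (\<Sum>y\<in>cube n. ?K y * (of_bool (y \<in> H) * D y))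
      + (\<Sum>y\<in>cube n. ?K y * (of_bool (\<sigma> y \<in> H) * D y))"
    unfolding sum.distrib [symmetric] distrib_left [symmetric]
    by (rule sum.cong, rule refl) (use D_split in metis)
  also have "(\<Sum>y\<in>cube n. ?K y * (of_bool (\<sigma> y \<in> H) * D y))
      = (\<Sum>y\<in>cube n. ?K (\<sigma> y) * (of_bool (\<sigma> (\<sigma> y) \<in> H) * D (\<sigma> y)))"
    by (rule sum_reflect [symmetric])
  also have "\<dots> = (\<Sum>y\<in>cube n. - ?K (\<sigma> y) * (of_bool (y \<in> H) * D y))"
    by (rule sum.cong) (simp_all add: reflect_reflect D\<sigma>)
  also have "(\<Sum>y\<in>cube n. ?K y * (of_bool (y \<in> H) * D y)) + \<dots>
      = (\<Sum>y\<in>cube n. of_bool (y \<in> H) * ((?K y - ?K (\<sigma> y)) * D y))"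
    unfolding sum.distrib [symmetric] by (rule sum.cong) (simp_all add: algebra_simps)
  also have "\<dots> = (\<Sum>y | y \<in> cube n \<and> y \<in> H. (?K y - ?K (\<sigma> y)) * D y)"
    by (rule sum.mono_neutral_cong_right) auto
  finally show ?thesis unfolding D_def .
qed

lemma noise_polarize_half_diff:
  assumes "x \<in> cube n"
  shows "noise n \<epsilon> (polarize f) x - noise n \<epsilon> (polarize f) (\<sigma> x) = (\<Sum>y | y \<in> cube n \<and> y \<in> H.
      (noise_kernel n \<epsilon> x y - noise_kernel n \<epsilon> x (\<sigma> y)) * \<bar>of_bool (f y) - of_bool (f (\<sigma> y))\<bar>)"
  unfolding noise_half_diff[OF assms] by (rule sum.cong) (simp_all add: polarize_half_diff)

text \<open>The triangle inequality with positive weights: polarizing replaces each difference of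
  \<open>f\<close> across the mirror by its absolute value.\<close>

lemma noise_diff_le_polarize:
  assumes x: "x \<in> cube n"
  shows "\<bar>noise n \<epsilon> f x - noise n \<epsilon> f (\<sigma> x)\<bar>
    \<le> \<bar>noise n \<epsilon> (polarize f) x - noise n \<epsilon> (polarize f) (\<sigma> x)\<bar>"
proof -
  have half: "\<bar>noise n \<epsilon> f x - noise n \<epsilon> f (\<sigma> x)\<bar>
    \<le> noise n \<epsilon> (polarize f) x - noise n \<epsilon> (polarize f) (\<sigma> x)"
    if "x \<in> cube n" "x \<in> H" for x
    unfolding noise_half_diff[OF that(1), of f] noise_polarize_half_diff[OF that(1), of f]
    by (rule sum_abs[THEN order_trans], rule sum_mono)
       (use kernel_half[OF that(1)] that in \<open>auto simp: abs_mult less_imp_le\<close>)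
  consider "x \<in> H" | "\<sigma> x \<in> H" | "\<sigma> x = x" using reflect_fixed[OF x] by blast
  then show ?thesis
  proof cases
    case 1
    then show ?thesis using half[OF x] by linarith
  next
    case 2
    then show ?thesis using half[OF reflect_cube[OF x]] reflect_reflect[OF x] by simp
  qed simp
qed

text \<open>The pairs of \<open>y\<close> and \<open>z\<close> contribute with opposite signs, so
  the triangle inequality is strict: \<open>z\<close> makes the bound on the sum strict, and
  \<open>y\<close> the bound on its negative.\<close>

lemma noise_diff_less_polarize:
  assumes x: "x \<in> cube n" "x \<in> H"
    and y: "y \<in> cube n" "y \<in> H" "f y" "\<not> f (\<sigma> y)"
    and z: "z \<in> cube n" "z \<in> H" "\<not> f z" "f (\<sigma> z)"
  shows "\<bar>noise n \<epsilon> f x - noise n \<epsilon> f (\<sigma> x)\<bar>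
    < \<bar>noise n \<epsilon> (polarize f) x - noise n \<epsilon> (polarize f) (\<sigma> x)\<bar>"
proof -
  let ?S = "{y. y \<in> cube n \<and> y \<in> H}"
  let ?w = "\<lambda>y. noise_kernel n \<epsilon> x y - noise_kernel n \<epsilon> x (\<sigma> y)"
  let ?D = "\<lambda>y. of_bool (f y) - of_bool (f (\<sigma> y)) :: real"
  have w: "0 < ?w y" if "y \<in> ?S" for y using kernel_half[OF x(1) _ x(2)] that by simp
  have "(\<Sum>y\<in>?S. ?w y * ?D y) < (\<Sum>y\<in>?S. ?w y * \<bar>?D y\<bar>)"
    by (rule sum_strict_mono_ex1)
       (use z w in \<open>auto intro!: mult_left_mono less_imp_le[OF w] bexI[of _ z]\<close>)
  moreover have "(\<Sum>y\<in>?S. ?w y * - ?D y) < (\<Sum>y\<in>?S. ?w y * \<bar>?D y\<bar>)"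
    by (rule sum_strict_mono_ex1)
       (use y w in \<open>auto intro!: mult_left_mono less_imp_le[OF w] bexI[of _ y]\<close>)
  then have "- (\<Sum>y\<in>?S. ?w y * ?D y) < (\<Sum>y\<in>?S. ?w y * \<bar>?D y\<bar>)"
    by (simp only: mult_minus_right sum_negf)
  ultimately show ?thesis
    unfolding noise_half_diff[OF x(1), of f] noise_polarize_half_diff[OF x(1), of f] by linarith
qed

text \<open>Count the sum twice and group it by pairs \<open>{x, \<sigma> x}\<close>. On each pair
  the values keep their sum and spread apart, so convexity applies.\<close>

lemma agreement_less_polarize:
  assumes "k \<ge> 2"
    and y: "y \<in> cube n" "y \<in> H" "f y" "\<not> f (\<sigma> y)"
    and z: "z \<in> cube n" "z \<in> H" "\<not> f z" "f (\<sigma> z)"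
  shows "(\<Sum>x\<in>cube n. noise n \<epsilon> f x ^ k + (1 - noise n \<epsilon> f x) ^ k)
    < (\<Sum>x\<in>cube n. noise n \<epsilon> (polarize f) x ^ k + (1 - noise n \<epsilon> (polarize f) x) ^ k)"
proof -
  define \<phi> where "\<phi> t = t ^ k + (1 - t) ^ k" for t :: real
  let ?T = "noise n \<epsilon> f" and ?T' = "noise n \<epsilon> (polarize f)"
  have double: "2 * (\<Sum>x\<in>cube n. h x) = (\<Sum>x\<in>cube n. h x + h (\<sigma> x))" for h :: "(nat \<Rightarrow> bool) \<Rightarrow> real"
    by (simp add: sum.distrib sum_reflect)
  have range: "0 \<le> ?T' x" "0 \<le> 1 - ?T' x" for x
    using noise_nonneg noise_le_1 eps by auto
  have le: "\<phi> (?T x) + \<phi> (?T (\<sigma> x)) \<le> \<phi> (?T' x) + \<phi> (?T' (\<sigma> x))" if x: "x \<in> cube n" for x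
  proof -
    note sum = noise_polarize_pair_sum[OF x, of f] and diff = noise_diff_le_polarize[OF x, of f]
    have "?T x ^ k + ?T (\<sigma> x) ^ k \<le> ?T' x ^ k + ?T' (\<sigma> x) ^ k"
      by (rule power_sum_le_spread_abs) (use range sum diff in auto)
    moreover have "(1 - ?T x) ^ k + (1 - ?T (\<sigma> x)) ^ k \<le> (1 - ?T' x) ^ k + (1 - ?T' (\<sigma> x)) ^ k"
      by (rule power_sum_le_spread_abs) (use range sum diff in auto)
    ultimately show ?thesis by (simp add: \<phi>_def)
  qed
  \<comment> \<open>One strict pair suffices, and that of \<open>y\<close> is one. Strictness is
    taken from the powers of \<open>T\<close> alone.\<close>
  have less: "\<phi> (?T y) + \<phi> (?T (\<sigma> y)) < \<phi> (?T' y) + \<phi> (?T' (\<sigma> y))"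
  proof -
    note sum = noise_polarize_pair_sum[OF y(1), of f]
      and diff = noise_diff_less_polarize[OF y(1,2) y z]
    have "?T y ^ k + ?T (\<sigma> y) ^ k < ?T' y ^ k + ?T' (\<sigma> y) ^ k"
      by (rule power_sum_le_spread_abs) (use range sum diff assms in auto)
    moreover have "(1 - ?T y) ^ k + (1 - ?T (\<sigma> y)) ^ k \<le> (1 - ?T' y) ^ k + (1 - ?T' (\<sigma> y)) ^ k"
      by (rule power_sum_le_spread_abs) (use range sum diff in auto)
    ultimately show ?thesis by (simp add: \<phi>_def)
  qed
  have "2 * (\<Sum>x\<in>cube n. \<phi> (?T x)) < 2 * (\<Sum>x\<in>cube n. \<phi> (?T' x))"
    unfolding double by (rule sum_strict_mono_ex1) (use le less y in auto)
  then show ?thesis by (simp add: \<phi>_def)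
qed

lemma sum_polarize: "(\<Sum>x\<in>cube n. of_bool (polarize f x)) = (\<Sum>x\<in>cube n. of_bool (f x) :: real)"
proof -
  have double: "2 * (\<Sum>x\<in>cube n. of_bool (h x)) = (\<Sum>x\<in>cube n. of_bool (h x) + of_bool (h (\<sigma> x)) :: real)" for h
    unfolding sum.distrib sum_reflect[of "\<lambda>x. of_bool (h x)"] by simp
  have "2 * (\<Sum>x\<in>cube n. of_bool (polarize f x)) = 2 * (\<Sum>x\<in>cube n. of_bool (f x) :: real)"
    unfolding double by (rule sum.cong) (simp_all only: polarize_pair_sum)
  then show ?thesis by simp
qed

lemma polarize_balanced:
  assumes "f \<in> balanced_functions n"
  shows "polarize f \<in> balanced_functions n"
proof -
  have card1: "real (card {x \<in> cube n. h x = True}) = (\<Sum>x\<in>cube n. of_bool (h x))" for h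
    by (simp add: Int_def)
  have card0: "card {x \<in> cube n. h x = False} = card (cube n) - card {x \<in> cube n. h x = True}" for h
    by (subst card_Diff_subset [symmetric]) (auto intro!: arg_cong[where f = card])
  have "real (card {x \<in> cube n. polarize f x = True}) = real (card {x \<in> cube n. f x = True})"
    unfolding card1 by (rule sum_polarize)
  then have "card {x \<in> cube n. polarize f x = True} = card {x \<in> cube n. f x = True}" by simp
  with assms show ?thesis
    unfolding balanced_functions_def card0 by (simp add: polarize_def)
qed

text \<open>Complementation commutes with \<open>\<sigma>\<close>, exchanges the two sides of the
  mirror and negates \<open>f\<close>; by De Morgan it turns the disjunction on one side into the
  conjunction on the other.\<close>

lemma polarize_antisymmetric:
  assumes "f \<in> antisymmetric_functions n"
  shows "polarize f \<in> antisymmetric_functions n"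
proof -
  have anti: "f (complement_string n x) = (\<not> f x)" if "x \<in> cube n" for x
    using assms that by (simp add: antisymmetric_functions_def)
  have "polarize f (complement_string n x) = (\<not> polarize f x)" if x: "x \<in> cube n" for x
  proof -
    have "\<sigma> (complement_string n x) \<in> H \<longleftrightarrow> x \<in> H"
      using complement_half[OF reflect_cube[OF x]] x by (simp add: reflect_complement reflect_reflect)
    then show ?thesis
      using x reflect_half[OF x]
      by (auto simp: polarize_def complement_half reflect_complement anti reflect_cube)
  qed
  then show ?thesis
    using assms polarize_balanced by (simp add: antisymmetric_functions_def)
qed

end

section \<open>Flips and exchanges of coordinates as reflections\<close>

lemma noise_kernel_remove:
  assumes "i \<in> {1..n}"
  shows "noise_kernel n \<epsilon> x y = (if y i = x i then 1 - \<epsilon> else \<epsilon>) *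
    (\<Prod>l\<in>{1..n} - {i}. if y l = x l then 1 - \<epsilon> else \<epsilon>)"
  unfolding noise_kernel_def using assms by (intro prod.remove) auto

lemma noise_kernel_remove2:
  assumes "i \<in> {1..n}" "j \<in> {1..n}" "i \<noteq> j"
  shows "noise_kernel n \<epsilon> x y =
    (if y i = x i then 1 - \<epsilon> else \<epsilon>) * (if y j = x j then 1 - \<epsilon> else \<epsilon>) *
    (\<Prod>l\<in>{1..n} - {i, j}. if y l = x l then 1 - \<epsilon> else \<epsilon>)"
proof -
  have "{1..n} - {i, j} = ({1..n} - {i}) - {j}" by auto
  then show ?thesis
    unfolding noise_kernel_remove[OF assms(1)] using assms
    by (subst prod.remove[of _ j]) auto
qed

text \<open>Two points of the half agree at \<open>i\<close>, so flipping one of them replaces a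
  single factor \<open>1 - \<epsilon>\<close> by the smaller \<open>\<epsilon>\<close>. No string is
  fixed.\<close>

lemma reflection_flip:
  assumes "0 < \<epsilon>" "\<epsilon> < 1/2" and i: "i \<in> {1..n}"
  shows "reflection n \<epsilon> (\<lambda>x. x(i := \<not> x i)) {x. x i}"
proof
  fix x y assume xy: "x \<in> cube n" "y \<in> cube n"
  let ?R = "\<Prod>l\<in>{1..n} - {i}. if y l = x l then 1 - \<epsilon> else \<epsilon>"
  show "noise_kernel n \<epsilon> (x(i := \<not> x i)) (y(i := \<not> y i)) = noise_kernel n \<epsilon> x y"
    unfolding noise_kernel_remove[OF i] by (intro arg_cong2[where f = "(*)"] prod.cong) auto
  assume "x \<in> {x. x i}" "y \<in> {x. x i}"
  then have "noise_kernel n \<epsilon> x (y(i := \<not> y i)) = \<epsilon> * ?R" "noise_kernel n \<epsilon> x y = (1 - \<epsilon>) * ?R"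
    unfolding noise_kernel_remove[OF i] by (auto intro!: prod.cong)
  moreover have "0 < ?R" using assms by (intro prod_pos) auto
  ultimately show "noise_kernel n \<epsilon> x (y(i := \<not> y i)) < noise_kernel n \<epsilon> x y"
    using assms by simp
next
  show "0 < \<epsilon>" "\<epsilon> < 1" using assms by auto
next
  fix x assume x: "x \<in> cube n"
  show "x(i := \<not> x i) \<in> cube n" using x i by simp
  show "complement_string n x \<in> {x. x i} \<longleftrightarrow> x(i := \<not> x i) \<in> {x. x i}" using i by simp
  show "(complement_string n x)(i := \<not> complement_string n x i) = complement_string n (x(i := \<not> x i))"
    using i by (intro ext) (simp add: complement_string_def)
qed simp_all

text \<open>
  The exchange of coordinates \<open>i\<close> and \<open>j\<close>, conjugated by the flips that turn the orientation
  \<open>s\<close> into the increasing one.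
\<close>

lemma reflection_exchange:
  assumes "0 < \<epsilon>" "\<epsilon> < 1/2" and i: "i \<in> {1..n}" and j: "j \<in> {1..n}" and "i \<noteq> j"
  shows "reflection n \<epsilon> (\<lambda>x. x(i := (x j \<longleftrightarrow> (s i \<longleftrightarrow> s j)), j := (x i \<longleftrightarrow> (s i \<longleftrightarrow> s j))))
    {x. (x i \<longleftrightarrow> s i) \<and> (x j \<longleftrightarrow> \<not> s j)}" (is "reflection n \<epsilon> ?\<sigma> ?H")
proof
  fix x y assume xy: "x \<in> cube n" "y \<in> cube n"
  let ?R = "\<Prod>l\<in>{1..n} - {i, j}. if y l = x l then 1 - \<epsilon> else \<epsilon>"
  note remove = noise_kernel_remove2[OF i j \<open>i \<noteq> j\<close>]
  have "(\<Prod>l\<in>{1..n} - {i, j}. if ?\<sigma> y l = ?\<sigma> x l then 1 - \<epsilon> else \<epsilon>) = ?R"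
    by (rule prod.cong) auto
  then show "noise_kernel n \<epsilon> (?\<sigma> x) (?\<sigma> y) = noise_kernel n \<epsilon> x y"
    unfolding remove using \<open>i \<noteq> j\<close> by auto
  assume "x \<in> ?H" "y \<in> ?H"
  moreover have "(\<Prod>l\<in>{1..n} - {i, j}. if ?\<sigma> y l = x l then 1 - \<epsilon> else \<epsilon>) = ?R"
    by (rule prod.cong) auto
  \<comment> \<open>All points of \<open>?H\<close> carry the same bits at \<open>i\<close> and
    \<open>j\<close>, and \<open>?\<sigma>\<close> reverses both.\<close>
  ultimately have "noise_kernel n \<epsilon> x (?\<sigma> y) = \<epsilon> * \<epsilon> * ?R"
    "noise_kernel n \<epsilon> x y = (1 - \<epsilon>) * (1 - \<epsilon>) * ?R"
    unfolding remove using \<open>i \<noteq> j\<close> by auto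
  moreover have "0 < ?R" using assms by (intro prod_pos) auto
  moreover have "\<epsilon> * \<epsilon> < (1 - \<epsilon>) * (1 - \<epsilon>)" using assms by (intro mult_strict_mono) auto
  ultimately show "noise_kernel n \<epsilon> x (?\<sigma> y) < noise_kernel n \<epsilon> x y" by simp
next
  show "0 < \<epsilon>" "\<epsilon> < 1" using assms by auto
next
  fix x assume x: "x \<in> cube n"
  show "?\<sigma> x \<in> cube n" using x i j by simp
  show "?\<sigma> (?\<sigma> x) = x" using \<open>i \<noteq> j\<close> by (intro ext) auto
  show "?\<sigma> x \<notin> ?H" if "x \<in> ?H" using that \<open>i \<noteq> j\<close> by auto
  \<comment> \<open>Off both sides, \<open>x\<close> follows \<open>s\<close> at both coordinates or
    at neither, and the exchange has no effect.\<close>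
  show "?\<sigma> x = x" if "x \<notin> ?H" "?\<sigma> x \<notin> ?H"
  proof
    show "?\<sigma> x l = x l" for l using that \<open>i \<noteq> j\<close> by (cases "l = i"; cases "l = j") auto
  qed
  show "?\<sigma> (complement_string n x) = complement_string n (?\<sigma> x)"
    using i j \<open>i \<noteq> j\<close> by (intro ext) (auto simp: complement_string_def)
  show "complement_string n x \<in> ?H \<longleftrightarrow> ?\<sigma> x \<in> ?H"
    using i j \<open>i \<noteq> j\<close> by auto
qed

section \<open>Maximizers\<close>

text \<open>The cube is nonempty and the two preimages have equal size. One point of each kind puts
  all values of the noise operator strictly between 0 and 1.\<close>

lemma balanced_attains:
  assumes "f \<in> balanced_functions n"
  obtains x y where "x \<in> cube n" "f x" "y \<in> cube n" "\<not> f y"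
proof -
  have eq: "card {x \<in> cube n. \<not> f x} = card {x \<in> cube n. f x}"
    using assms by (simp add: balanced_functions_def)
  obtain z where z: "z \<in> cube n" using cube_nonempty by blast
  have "{x \<in> cube n. f x} \<noteq> {} \<and> {x \<in> cube n. \<not> f x} \<noteq> {}"
  proof (cases "f z")
    case True
    then have "card {x \<in> cube n. f x} > 0" using z by (auto simp: card_gt_0_iff)
    with eq have "card {x \<in> cube n. \<not> f x} > 0" by simp
    then show ?thesis using z True by (auto simp: card_gt_0_iff)
  next
    case False
    then have "card {x \<in> cube n. \<not> f x} > 0" using z by (auto simp: card_gt_0_iff)
    with eq have "card {x \<in> cube n. f x} > 0" by simp
    then show ?thesis using z False by (auto simp: card_gt_0_iff)
  qed
  then show ?thesis using that by blast
qed

text \<open>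
  Replacing \<open>p j\<close> by \<open>p i\<close>, respectively \<open>p i\<close> by \<open>p j\<close>, cannot increase the agreement
  probability; by \<open>a\<^sup>2 + b\<^sup>2 - 2 a b = (a - b)\<^sup>2\<close> the sum of the two changes is a weighted
  sum of squares with positive weights.
\<close>

lemma maximizer_all_equal:
  assumes eps: "0 < \<epsilon>" "\<epsilon> < 1/2"
    and F: "F \<subseteq> balanced_functions n"
    and max: "is_arg_max (agreement_prob n k \<epsilon>) (\<lambda>f. f \<in> {1..k} \<rightarrow>\<^sub>E F) p"
    and i: "i \<in> {1..k}" and j: "j \<in> {1..k}"
  shows "p i = p j"
proof (cases "i = j")
  case False
  define T where "T l = noise n \<epsilon> (p l)" for l
  have eps1: "\<epsilon> < 1" and k: "k \<ge> 1" using eps i by auto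
  have p: "p \<in> {1..k} \<rightarrow>\<^sub>E F" using max by (simp add: is_arg_max_def)
  have T01: "0 < T l x" "T l x < 1" if "l \<in> {1..k}" for l x
  proof -
    have "p l \<in> balanced_functions n" using p that F by auto
    then obtain a b where ab: "a \<in> cube n" "p l a" "b \<in> cube n" "\<not> p l b"
      by (rule balanced_attains)
    show "0 < T l x" unfolding T_def using eps(1) eps1 ab(1,2) by (rule noise_pos)
    show "T l x < 1" unfolding T_def using eps(1) eps1 ab(3,4) by (rule noise_less_1)
  qed
  define C where "C = {1..k} - {i, j}"
  \<comment> \<open>\<open>R\<close> and \<open>R'\<close> collect the other players, whom the
    replacements leave alone; they are the positive weights of the squares.\<close>
  define R where "R x = (\<Prod>l\<in>C. T l x)" for x
  define R' where "R' x = (\<Prod>l\<in>C. 1 - T l x)" for x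
  have R: "0 < R x" "0 < R' x" for x
    using T01 by (auto simp: R_def R'_def C_def intro!: prod_pos)
  have prod: "(\<Prod>l\<in>{1..k}. h l) = h i * h j * (\<Prod>l\<in>C. h l)" for h :: "nat \<Rightarrow> real"
  proof -
    have *: "{1..k} = insert i (insert j C)" using i j by (auto simp: C_def)
    show ?thesis unfolding * using False by (simp add: C_def)
  qed
  let ?N = "real (card (cube n))"
  have N: "0 < ?N" by (simp add: card_gt_0_iff)
  have P: "agreement_prob n k \<epsilon> q * ?N
      = (\<Sum>x\<in>cube n. noise n \<epsilon> (q i) x * noise n \<epsilon> (q j) x * R x
          + (1 - noise n \<epsilon> (q i) x) * (1 - noise n \<epsilon> (q j) x) * R' x)"
    if "\<And>l. l \<in> C \<Longrightarrow> q l = p l" for q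
  proof -
    have "(\<Prod>l\<in>C. noise n \<epsilon> (q l) x) = R x" "(\<Prod>l\<in>C. 1 - noise n \<epsilon> (q l) x) = R' x" for x
      unfolding R_def R'_def T_def by (simp_all add: that)
    then show ?thesis
      unfolding agreement_prob_eq[OF eps(1) eps1 k] prod using N by simp
  qed
  let ?q1 = "p(j := p i)" and ?q2 = "p(i := p j)"
  have q: "agreement_prob n k \<epsilon> q \<le> agreement_prob n k \<epsilon> p" if "q \<in> {1..k} \<rightarrow>\<^sub>E F" for q
    using max that by (auto simp: is_arg_max_def not_less)
  have "?q1 \<in> {1..k} \<rightarrow>\<^sub>E F" "?q2 \<in> {1..k} \<rightarrow>\<^sub>E F"
    using p i j by (auto simp: PiE_iff extensional_def)
  then have "agreement_prob n k \<epsilon> ?q1 * ?N + agreement_prob n k \<epsilon> ?q2 * ?N \<le> 2 * (agreement_prob n k \<epsilon> p * ?N)"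
    using q N by (smt (verit) mult_right_mono)
  then have "(\<Sum>x\<in>cube n. T i x * T i x * R x + (1 - T i x) * (1 - T i x) * R' x)
      + (\<Sum>x\<in>cube n. T j x * T j x * R x + (1 - T j x) * (1 - T j x) * R' x)
      - 2 * (\<Sum>x\<in>cube n. T i x * T j x * R x + (1 - T i x) * (1 - T j x) * R' x) \<le> 0"
    using False by (subst (asm) (1 2 3) P) (auto simp: C_def T_def)
  also have "(\<Sum>x\<in>cube n. T i x * T i x * R x + (1 - T i x) * (1 - T i x) * R' x)
      + (\<Sum>x\<in>cube n. T j x * T j x * R x + (1 - T j x) * (1 - T j x) * R' x)
      - 2 * (\<Sum>x\<in>cube n. T i x * T j x * R x + (1 - T i x) * (1 - T j x) * R' x)
      = (\<Sum>x\<in>cube n. (T i x - T j x)\<^sup>2 * (R x + R' x))"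
    unfolding sum_distrib_left sum.distrib [symmetric] sum_subtractf [symmetric]
    by (rule sum.cong) (simp_all add: algebra_simps power2_eq_square)
  finally have le: "(\<Sum>x\<in>cube n. (T i x - T j x)\<^sup>2 * (R x + R' x)) \<le> 0" .
  have nonneg: "0 \<le> (T i x - T j x)\<^sup>2 * (R x + R' x)" for x
    using R[of x] by simp
  then have "(\<Sum>x\<in>cube n. (T i x - T j x)\<^sup>2 * (R x + R' x)) = 0"
    using le by (intro antisym sum_nonneg)
  then have "(T i x - T j x)\<^sup>2 * (R x + R' x) = 0" if "x \<in> cube n" for x
    using nonneg that by (subst (asm) sum_nonneg_eq_0_iff) auto
  then have "T i x = T j x" if "x \<in> cube n" for x
    using R[of x] that by (smt (verit) mult_eq_0_iff power2_eq_square)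
  then have eq: "p i x = p j x" if "x \<in> cube n" for x
    using that eps unfolding T_def by (intro noise_inj[of \<epsilon> n "p i" "p j" x]) auto
  have "p i \<in> extensional (cube n)" "p j \<in> extensional (cube n)"
    using p i j F by (auto simp: balanced_functions_def PiE_iff)
  then show ?thesis using eq by (rule extensionalityI)
qed simp

text \<open>If neither direction holds, two pairs are sorted oppositely. Polarizing the common
  function for all players at once then stays in the class and strictly increases the agreement
  probability.\<close>

lemma maximizer_sign:
  assumes r: "reflection n \<epsilon> \<sigma> H" and k: "k \<ge> 2"
    and F: "F \<in> {balanced_functions n, antisymmetric_functions n}"
    and max: "is_arg_max (agreement_prob n k \<epsilon>) (\<lambda>f. f \<in> {1..k} \<rightarrow>\<^sub>E F) p"
    and g: "\<And>i. i \<in> {1..k} \<Longrightarrow> p i = g"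
  shows "(\<forall>x\<in>cube n. x \<in> H \<longrightarrow> g (\<sigma> x) \<le> g x) \<or> (\<forall>x\<in>cube n. x \<in> H \<longrightarrow> g x \<le> g (\<sigma> x))"
proof (rule ccontr)
  interpret reflection n \<epsilon> \<sigma> H by (rule r)
  assume "\<not> ?thesis"
  then obtain y z where y: "y \<in> cube n" "y \<in> H" "g y" "\<not> g (\<sigma> y)"
    and z: "z \<in> cube n" "z \<in> H" "\<not> g z" "g (\<sigma> z)" by auto
  have "p \<in> {1..k} \<rightarrow>\<^sub>E F" using max by (simp add: is_arg_max_def)
  then have "g \<in> F" using g[of 1] k by (auto simp: PiE_iff)
  then have "polarize g \<in> F" using F polarize_balanced polarize_antisymmetric by blast
  then have "(\<lambda>i\<in>{1..k}. polarize g) \<in> {1..k} \<rightarrow>\<^sub>E F" by auto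
  then have "\<not> agreement_prob n k \<epsilon> p < agreement_prob n k \<epsilon> (\<lambda>i\<in>{1..k}. polarize g)"
    using max by (auto simp: is_arg_max_def)
  moreover have "agreement_prob n k \<epsilon> q = (\<Sum>x\<in>cube n. noise n \<epsilon> h x ^ k + (1 - noise n \<epsilon> h x) ^ k)
      / real (card (cube n))" if "\<And>i. i \<in> {1..k} \<Longrightarrow> q i = h" for q h
    using that eps k by (simp add: agreement_prob_eq)
  then have "agreement_prob n k \<epsilon> p < agreement_prob n k \<epsilon> (\<lambda>i\<in>{1..k}. polarize g)"
    using agreement_less_polarize[where f = g, OF k y z] g
    by (simp add: divide_strict_right_mono card_gt_0_iff)
  ultimately show False by blast
qed

section \<open>From coordinate exchanges to left-monotonicity\<close>

text \<open>Induction on the Hamming distance: starting from \<open>y\<close>, elementary moves lead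
  to \<open>x\<close> while staying above \<open>x\<close> in the order and never increasing
  \<open>G\<close>.\<close>

lemma left_monotoneI:
  assumes mono: "\<And>x i. x \<in> cube n \<Longrightarrow> i \<in> {1..n} \<Longrightarrow> G (x(i := False)) \<le> G (x(i := True))"
    and shift: "\<And>x i j. x \<in> cube n \<Longrightarrow> i \<in> {1..n} \<Longrightarrow> j \<in> {1..n} \<Longrightarrow> i < j \<Longrightarrow>
      G (x(i := False, j := True)) \<le> G (x(i := True, j := False))"
  shows "left_monotone n G"
proof -
  have "G x \<le> G y" if "x \<in> cube n" "y \<in> cube n" "left_le n x y" for x y
    using that
  proof (induction "card {i \<in> {1..n}. x i \<noteq> y i}" arbitrary: y rule: less_induct)
    case less
    note x = \<open>x \<in> cube n\<close> and y = \<open>y \<in> cube n\<close>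
    show ?case
    proof (cases "x = y")
      case False
      then have ex: "\<exists>i. i \<in> {1..n} \<and> x i \<noteq> y i" using cube_eqI[OF x y] by blast
      define m where "m = (LEAST i. i \<in> {1..n} \<and> x i \<noteq> y i)"
      have m: "m \<in> {1..n}" "x m \<noteq> y m"
        using LeastI_ex[OF ex] by (auto simp: m_def)
      \<comment> \<open>It suffices to find \<open>y'\<close> that changes \<open>y\<close> only to
        bits of \<open>x\<close>, and does so at \<open>m\<close>; it is then closer to
        \<open>x\<close>.\<close>
      have step: ?thesis if y': "y' \<in> cube n" "left_le n x y'" "G y' \<le> G y"
        and toward: "y' m \<noteq> y m" "\<And>i. y' i \<noteq> y i \<Longrightarrow> x i = y' i" for y'
      proof -
        have "{i \<in> {1..n}. x i \<noteq> y' i} \<subseteq> {i \<in> {1..n}. x i \<noteq> y i}" using toward(2) by force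
        moreover have "m \<in> {i \<in> {1..n}. x i \<noteq> y i}" "m \<notin> {i \<in> {1..n}. x i \<noteq> y' i}"
          using m toward(2)[OF toward(1)] by simp_all
        ultimately have "{i \<in> {1..n}. x i \<noteq> y' i} \<subset> {i \<in> {1..n}. x i \<noteq> y i}" by blast
        then have "card {i \<in> {1..n}. x i \<noteq> y' i} < card {i \<in> {1..n}. x i \<noteq> y i}"
          by (intro psubset_card_mono) auto
        then have "G x \<le> G y'" using x y'(1,2) by (rule less.hyps)
        with y'(3) show ?thesis by simp
      qed
      have below: "x i = y i" if "i \<in> {1..<m}" for i
        using not_less_Least[of i "\<lambda>i. i \<in> {1..n} \<and> x i \<noteq> y i"] that m by (auto simp: m_def)
      have "{1..m} = insert m {1..<m}" using m by auto
      moreover have "(\<Sum>i\<in>{1..<m}. of_bool (x i)) = (\<Sum>i\<in>{1..<m}. of_bool (y i) :: nat)"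
        by (rule sum.cong) (auto simp: below)
      moreover have "(\<Sum>i=1..m. of_bool (x i) :: nat) \<le> (\<Sum>i=1..m. of_bool (y i))"
        using less.prems(3) m by (simp add: left_le_def)
      ultimately have "of_bool (x m) \<le> (of_bool (y m) :: nat)"
        by (simp del: sum_of_bool_eq)
      then have xm: "\<not> x m" and ym: "y m" using m(2) by auto
      show ?thesis
      proof (cases "\<exists>j. j \<in> {m<..n} \<and> x j \<and> \<not> y j")
        case ex: True
        define j where "j = (LEAST j. j \<in> {m<..n} \<and> x j \<and> \<not> y j)"
        have j: "j \<in> {m<..n}" "x j" "\<not> y j"
          using LeastI_ex[OF ex] by (auto simp: j_def)
        have between: "x i \<le> y i" if "i \<in> {m<..<j}" for i
          using not_less_Least[of i "\<lambda>j. j \<in> {m<..n} \<and> x j \<and> \<not> y j"] that j by (auto simp: j_def)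
        \<comment> \<open>An instance of \<open>shift\<close>. Before \<open>j\<close>,
          \<open>x\<close> lies bitwise below \<open>y'\<close>; from \<open>j\<close> on, the
          prefix sums of \<open>y'\<close> are those of \<open>y\<close>.\<close>
        define y' where "y' = y(m := False, j := True)"
        have "y(m := True, j := False) = y" using ym j m by (auto simp: fun_eq_iff)
        then have Gy: "G y' \<le> G y"
          using shift[OF y m(1), of j] j m by (auto simp: y'_def)
        have "(\<Sum>i=1..q. of_bool (x i) :: nat) \<le> (\<Sum>i=1..q. of_bool (y' i))" if q: "q \<in> {1..n}" for q
        proof (cases "q < j")
          case True
          have "x i \<le> y' i" if "i \<in> {1..q}" for i
            using that True xm below[of i] between[of i] by (cases i m rule: linorder_cases) (auto simp: y'_def)
          then show ?thesis by (intro sum_mono) (auto simp: of_bool_def)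
        next
          case False
          have split: "(\<Sum>i=1..q. h i) = h m + (h j + (\<Sum>i\<in>{1..q} - {m} - {j}. h i))"
            for h :: "nat \<Rightarrow> nat"
            using False m j by (subst sum.remove[of _ m], simp, simp, subst sum.remove[of _ j]) auto
          have "(\<Sum>i=1..q. of_bool (y' i) :: nat) = (\<Sum>i=1..q. of_bool (y i))"
            unfolding split using j m ym by (auto simp: y'_def intro!: sum.cong)
          then show ?thesis using less.prems(3) q by (simp add: left_le_def)
        qed
        then have "left_le n x y'" by (simp add: left_le_def)
        moreover have "y' \<in> cube n" using y m j by (auto simp: y'_def)
        moreover have "y' m \<noteq> y m" using ym j by (simp add: y'_def)
        moreover have "x i = y' i" if "y' i \<noteq> y i" for i
          using that xm j(2) by (auto simp: y'_def split: if_splits)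
        ultimately show ?thesis using Gy by (intro step)
      next
        case none: False
        \<comment> \<open>No place after \<open>m\<close> has a one in \<open>x\<close> and a zero
          in \<open>y\<close>, so clearing bit \<open>m\<close> leaves \<open>x\<close> bitwise
          below.\<close>
        define y' where "y' = y(m := False)"
        have "y(m := True) = y" using ym by (auto simp: fun_eq_iff)
        then have Gy: "G y' \<le> G y" using mono[OF y m(1)] by (simp add: y'_def)
        have "x i \<le> y' i" if "i \<in> {1..n}" for i
          using that xm below[of i] none by (cases i m rule: linorder_cases) (auto simp: y'_def)
        then have "left_le n x y'"
          unfolding left_le_def by (intro ballI sum_mono) (auto simp: of_bool_def)
        moreover have "y' \<in> cube n" using y m by (auto simp: y'_def)
        moreover have "y' m \<noteq> y m" using ym by (simp add: y'_def)
        moreover have "x i = y' i" if "y' i \<noteq> y i" for i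
          using that xm by (auto simp: y'_def split: if_splits)
        ultimately show ?thesis using Gy by (intro step)
      qed
    qed simp
  qed
  then show ?thesis by (simp add: left_monotone_def)
qed

text \<open>Sort by the number of \<open>R\<close>-predecessors; ties are harmless, because equal
  ranks are related both ways.\<close>

lemma sorting_permutation:
  fixes R :: "nat \<Rightarrow> nat \<Rightarrow> bool"
  assumes total: "\<And>i j. i \<in> {1..n} \<Longrightarrow> j \<in> {1..n} \<Longrightarrow> R i j \<or> R j i"
    and trans: "\<And>i j l. i \<in> {1..n} \<Longrightarrow> j \<in> {1..n} \<Longrightarrow> l \<in> {1..n} \<Longrightarrow> R i j \<Longrightarrow> R j l \<Longrightarrow> R i l"
  shows "\<exists>e. e permutes {1..n} \<and> (\<forall>p\<in>{1..n}. \<forall>q\<in>{1..n}. p < q \<longrightarrow> R (e p) (e q))"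
proof -
  define c where "c j = card {i \<in> {1..n}. R i j}" for j
  have R: "R i j" if "i \<in> {1..n}" "j \<in> {1..n}" "c i \<le> c j" for i j
  proof (rule ccontr)
    assume "\<not> R i j"
    \<comment> \<open>By totality \<open>R j i\<close> holds, so predecessors of \<open>j\<close>
      precede \<open>i\<close>; \<open>i\<close> itself precedes \<open>i\<close> but not
      \<open>j\<close>.\<close>
    then have "{l \<in> {1..n}. R l j} \<subset> {l \<in> {1..n}. R l i}"
      using that total[of i j] total[of i i] trans[of _ j i] by blast
    then have "c j < c i" unfolding c_def by (intro psubset_card_mono) auto
    with that show False by simp
  qed
  define xs where "xs = sort_key c [1..<Suc n]"
  have len: "length xs = n" and set: "set xs = {1..n}" and "distinct xs" and "sorted (map c xs)"
    by (auto simp: xs_def)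
  \<comment> \<open>List positions start at 0 and coordinates at 1.\<close>
  define e where "e p = (if p \<in> {1..n} then xs ! (p - 1) else p)" for p
  have "bij_betw (\<lambda>p. p - 1) {1..n} {..<n}"
    by (rule bij_betwI[where g = Suc]) auto
  moreover have "bij_betw ((!) xs) {..<n} {1..n}"
    by (rule bij_betw_nth) (simp_all add: \<open>distinct xs\<close> len set)
  ultimately have "bij_betw ((!) xs \<circ> (\<lambda>p. p - 1)) {1..n} {1..n}" by (rule bij_betw_trans)
  then have bij: "bij_betw e {1..n} {1..n}"
    by (rule bij_betw_cong[THEN iffD1, rotated]) (simp add: e_def)
  then have "e permutes {1..n}" by (rule bij_imp_permutes) (auto simp: e_def)
  moreover have "R (e p) (e q)" if "p \<in> {1..n}" "q \<in> {1..n}" "p < q" for p q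
  proof (rule R)
    show "e p \<in> {1..n}" "e q \<in> {1..n}" using bij that by (auto dest: bij_betwE)
    show "c (e p) \<le> c (e q)"
      using that \<open>sorted (map c xs)\<close> len sorted_nth_mono[of "map c xs" "p - 1" "q - 1"]
      by (simp add: e_def)
  qed
  ultimately show ?thesis by blast
qed

section \<open>Relabelling and flipping coordinates\<close>

lemma perm_flip_upd:
  assumes "\<pi> permutes {1..n}" "i \<in> {1..n}"
  shows "perm_flip n \<pi> S (x(\<pi> i := b)) = (perm_flip n \<pi> S x)(i := (b \<longleftrightarrow> i \<in> S))"
proof
  fix l
  have "\<pi> l = \<pi> i \<longleftrightarrow> l = i" by (rule inj_eq[OF permutes_inj[OF assms(1)]])
  then show "perm_flip n \<pi> S (x(\<pi> i := b)) l = ((perm_flip n \<pi> S x)(i := (b \<longleftrightarrow> i \<in> S))) l"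
    using assms(2) by (auto simp: perm_flip_def)
qed

lemma perm_flip_in_cube [simp]: "perm_flip n \<pi> S x \<in> cube n"
  by (auto simp: perm_flip_def cube_def)

lemma left_monotone_up_to_perm_flipI:
  assumes mono: "\<And>x i. x \<in> cube n \<Longrightarrow> i \<in> {1..n} \<Longrightarrow> g (x(i := \<not> s i)) \<le> g (x(i := s i))"
    and dom: "\<And>i j. i \<in> {1..n} \<Longrightarrow> j \<in> {1..n} \<Longrightarrow> i \<noteq> j \<Longrightarrow>
      (\<forall>x\<in>cube n. g (x(i := \<not> s i, j := s j)) \<le> g (x(i := s i, j := \<not> s j))) \<or>
      (\<forall>x\<in>cube n. g (x(j := \<not> s j, i := s i)) \<le> g (x(j := s j, i := \<not> s i)))"
  shows "left_monotone_up_to_perm_flip n g"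
proof -
  define R where "R i j \<longleftrightarrow> i = j \<or>
    (\<forall>x\<in>cube n. g (x(i := \<not> s i, j := s j)) \<le> g (x(i := s i, j := \<not> s j)))" for i j
  have R_trans: "R i l" if ijl: "i \<in> {1..n}" "j \<in> {1..n}" "l \<in> {1..n}" and "R i j" "R j l" for i j l
  proof (cases "i = j \<or> j = l \<or> i = l")
    case False
    then have ne: "i \<noteq> j" "j \<noteq> l" "i \<noteq> l" by auto
    have ij: "g (x(i := \<not> s i, j := s j)) \<le> g (x(i := s i, j := \<not> s j))" if "x \<in> cube n" for x
      using \<open>R i j\<close> ne that by (simp add: R_def)
    have jl: "g (x(j := \<not> s j, l := s l)) \<le> g (x(j := s j, l := \<not> s l))" if "x \<in> cube n" for x
      using \<open>R j l\<close> ne that by (simp add: R_def)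
    have "g (x(i := \<not> s i, l := s l)) \<le> g (x(i := s i, l := \<not> s l))" if x: "x \<in> cube n" for x
    \<comment> \<open>The exchange of \<open>i\<close> and \<open>l\<close> is composed of one of
      \<open>i\<close> with \<open>j\<close> and one of \<open>j\<close> with \<open>l\<close>; the
      bit at \<open>j\<close> decides which can come first.\<close>
    proof (cases "x j = s j")
      case True
      have "g (x(i := \<not> s i, l := s l)) = g ((x(l := s l))(i := \<not> s i, j := s j))"
        using True ne by (intro arg_cong[where f = g]) (auto simp: fun_eq_iff)
      also have "\<dots> \<le> g ((x(l := s l))(i := s i, j := \<not> s j))"
        using x ijl by (intro ij) simp
      also have "g ((x(l := s l))(i := s i, j := \<not> s j)) = g ((x(i := s i))(j := \<not> s j, l := s l))"
        using ne by (intro arg_cong[where f = g]) (auto simp: fun_eq_iff)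
      also have "\<dots> \<le> g ((x(i := s i))(j := s j, l := \<not> s l))"
        using x ijl by (intro jl) simp
      also have "g ((x(i := s i))(j := s j, l := \<not> s l)) = g (x(i := s i, l := \<not> s l))"
        using True ne by (intro arg_cong[where f = g]) (auto simp: fun_eq_iff)
      finally show ?thesis .
    next
      case False
      have "g (x(i := \<not> s i, l := s l)) = g ((x(i := \<not> s i))(j := \<not> s j, l := s l))"
        using False ne by (intro arg_cong[where f = g]) (auto simp: fun_eq_iff)
      also have "\<dots> \<le> g ((x(i := \<not> s i))(j := s j, l := \<not> s l))"
        using x ijl by (intro jl) simp
      also have "g ((x(i := \<not> s i))(j := s j, l := \<not> s l)) = g ((x(l := \<not> s l))(i := \<not> s i, j := s j))"
        using ne by (intro arg_cong[where f = g]) (auto simp: fun_eq_iff)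
      also have "\<dots> \<le> g ((x(l := \<not> s l))(i := s i, j := \<not> s j))"
        using x ijl by (intro ij) simp
      also have "g ((x(l := \<not> s l))(i := s i, j := \<not> s j)) = g (x(i := s i, l := \<not> s l))"
        using False ne by (intro arg_cong[where f = g]) (auto simp: fun_eq_iff)
      finally show ?thesis .
    qed
    then show ?thesis by (simp add: R_def)
  qed (use \<open>R i j\<close> \<open>R j l\<close> in \<open>auto simp: R_def\<close>)
  have R_total: "R i j \<or> R j i" if "i \<in> {1..n}" "j \<in> {1..n}" for i j
    unfolding R_def using dom[OF that] by blast
  have "\<exists>e. e permutes {1..n} \<and> (\<forall>p\<in>{1..n}. \<forall>q\<in>{1..n}. p < q \<longrightarrow> R (e p) (e q))"
    by (rule sorting_permutation) (fact R_total, fact R_trans)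
  then obtain e where e: "e permutes {1..n}"
    and eR: "\<And>p q. p \<in> {1..n} \<Longrightarrow> q \<in> {1..n} \<Longrightarrow> p < q \<Longrightarrow> R (e p) (e q)"
    by blast
  \<comment> \<open>\<open>perm_flip\<close> reads its input through \<open>\<pi>\<close>, so with
    the inverse of \<open>e\<close> input place \<open>p\<close> controls coordinate
    \<open>e p\<close>. By the choice of \<open>S\<close>, a true bit there becomes the favoured
    value \<open>s (e p)\<close>.\<close>
  define \<pi> where "\<pi> = inv e"
  define S where "S = {i \<in> {1..n}. s i}"
  have \<pi>: "\<pi> permutes {1..n}" unfolding \<pi>_def by (rule permutes_inv[OF e])
  have e_in: "e p \<in> {1..n}" if "p \<in> {1..n}" for p using permutes_in_image[OF e] that by blast
  have upd: "perm_flip n \<pi> S (x(p := b)) = (perm_flip n \<pi> S x)(e p := (b \<longleftrightarrow> s (e p)))"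
    if "p \<in> {1..n}" for x p b
  proof -
    have "\<pi> (e p) = p" unfolding \<pi>_def by (rule permutes_inverses(2)[OF e])
    then show ?thesis using perm_flip_upd[OF \<pi> e_in[OF that], of S x b] e_in[OF that]
      by (simp add: S_def)
  qed
  have "left_monotone n (g \<circ> perm_flip n \<pi> S)"
  proof (rule left_monotoneI)
    fix x p assume "p \<in> {1..n}"
    then show "(g \<circ> perm_flip n \<pi> S) (x(p := False)) \<le> (g \<circ> perm_flip n \<pi> S) (x(p := True))"
      using mono[of "perm_flip n \<pi> S x" "e p"] e_in by (simp add: upd)
  next
    fix x p q assume pq: "p \<in> {1..n}" "q \<in> {1..n}" "p < (q :: nat)"
    then have "e p \<noteq> e q" using inj_eq[OF permutes_inj[OF e], of p q] by simp
    then have "g (y(e p := \<not> s (e p), e q := s (e q))) \<le> g (y(e p := s (e p), e q := \<not> s (e q)))"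
      if "y \<in> cube n" for y
      using eR[OF pq] that by (simp add: R_def)
    then show "(g \<circ> perm_flip n \<pi> S) (x(p := False, q := True))
        \<le> (g \<circ> perm_flip n \<pi> S) (x(p := True, q := False))"
      using pq by (simp add: upd)
  qed
  moreover have "S \<subseteq> {1..n}" by (auto simp: S_def)
  ultimately show ?thesis using \<pi> by (auto simp: left_monotone_up_to_perm_flip_def)
qed

section \<open>Optimal protocols, for both classes of functions at once\<close>

lemma maximizer_left_monotone:
  assumes eps: "0 < \<epsilon>" "\<epsilon> < 1/2" and k: "k \<ge> 2"
    and F: "F \<in> {balanced_functions n, antisymmetric_functions n}"
    and max: "is_arg_max (agreement_prob n k \<epsilon>) (\<lambda>f. f \<in> {1..k} \<rightarrow>\<^sub>E F) p"
  shows "\<exists>g. (\<forall>i \<in> {1..k}. p i = g) \<and> left_monotone_up_to_perm_flip n g"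
proof -
  have "F \<subseteq> balanced_functions n" using F by (auto simp: antisymmetric_functions_def)
  then have p: "p i = p 1" if "i \<in> {1..k}" for i
    using maximizer_all_equal[OF eps _ max that, of 1] k by auto
  define g where "g = p 1"
  note sign = maximizer_sign[OF _ k F max p, folded g_def]
  \<comment> \<open>The half is the set of strings with bit \<open>i\<close> set, so the two
    alternatives of \<open>maximizer_sign\<close> yield True and False for \<open>b\<close>.\<close>
  have "\<exists>b. \<forall>x\<in>cube n. g (x(i := \<not> b)) \<le> g (x(i := b))" if i: "i \<in> {1..n}" for i
    using sign[OF reflection_flip[OF eps i]]
  proof
    assume *: "\<forall>x\<in>cube n. x \<in> {x. x i} \<longrightarrow> g (x(i := \<not> x i)) \<le> g x"
    have "g (x(i := \<not> True)) \<le> g (x(i := True))" if "x \<in> cube n" for x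
      using *[rule_format, of "x(i := True)"] that i by simp
    then show ?thesis by blast
  next
    assume *: "\<forall>x\<in>cube n. x \<in> {x. x i} \<longrightarrow> g x \<le> g (x(i := \<not> x i))"
    have "g (x(i := \<not> False)) \<le> g (x(i := False))" if "x \<in> cube n" for x
      using *[rule_format, of "x(i := True)"] that i by simp
    then show ?thesis by blast
  qed
  then obtain s where s: "\<And>i x. i \<in> {1..n} \<Longrightarrow> x \<in> cube n \<Longrightarrow> g (x(i := \<not> s i)) \<le> g (x(i := s i))"
    by metis
  have "left_monotone_up_to_perm_flip n g"
  proof (rule left_monotone_up_to_perm_flipI[of n g s])
    fix i j assume ij: "i \<in> {1..n}" "j \<in> {1..n}" "i \<noteq> j"
    \<comment> \<open>The string \<open>x(i := s i, j := \<not> s j)\<close> is the general point of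
      the half, and this computes its mirror image.\<close>
    have red: "(x(i := s i, j := \<not> s j))(i := (\<not> s j \<longleftrightarrow> (s i \<longleftrightarrow> s j)), j := (s i \<longleftrightarrow> (s i \<longleftrightarrow> s j)))
        = x(i := \<not> s i, j := s j)" for x
      using ij by (auto simp: fun_eq_iff)
    have comm: "x(j := a, i := b) = x(i := b, j := a)" for x a b using ij by (auto simp: fun_eq_iff)
    show "(\<forall>x\<in>cube n. g (x(i := \<not> s i, j := s j)) \<le> g (x(i := s i, j := \<not> s j))) \<or>
      (\<forall>x\<in>cube n. g (x(j := \<not> s j, i := s i)) \<le> g (x(j := s j, i := \<not> s i)))"
      using sign[OF reflection_exchange[OF eps ij, of s]]
    proof
      assume *: "\<forall>x\<in>cube n. x \<in> {x. (x i \<longleftrightarrow> s i) \<and> (x j \<longleftrightarrow> \<not> s j)} \<longrightarrow>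
        g (x(i := (x j \<longleftrightarrow> (s i \<longleftrightarrow> s j)), j := (x i \<longleftrightarrow> (s i \<longleftrightarrow> s j)))) \<le> g x"
      have "g (x(i := \<not> s i, j := s j)) \<le> g (x(i := s i, j := \<not> s j))" if "x \<in> cube n" for x
        using *[rule_format, of "x(i := s i, j := \<not> s j)"] that ij red[of x] by simp
      then show ?thesis by blast
    next
      assume *: "\<forall>x\<in>cube n. x \<in> {x. (x i \<longleftrightarrow> s i) \<and> (x j \<longleftrightarrow> \<not> s j)} \<longrightarrow>
        g x \<le> g (x(i := (x j \<longleftrightarrow> (s i \<longleftrightarrow> s j)), j := (x i \<longleftrightarrow> (s i \<longleftrightarrow> s j))))"
      have "g (x(i := s i, j := \<not> s j)) \<le> g (x(i := \<not> s i, j := s j))" if "x \<in> cube n" for x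
        using *[rule_format, of "x(i := s i, j := \<not> s j)"] that ij red[of x] by simp
      then show ?thesis unfolding comm by blast
    qed
  qed (rule s)
  then show ?thesis using p unfolding g_def by blast
qed

theorem theorem1p4:
  fixes n k :: nat and \<epsilon> :: real
  assumes "k \<ge> 2" and "n \<ge> 1" and "0 < \<epsilon>" and "\<epsilon> < 1/2"
  shows
    "(\<forall>f. is_arg_max (agreement_prob n k \<epsilon>) (\<lambda>f. f \<in> protocols n k) f \<longrightarrow>
        (\<exists>g. (\<forall>i \<in> {1..k}. f i = g) \<and> left_monotone_up_to_perm_flip n g))
     \<and> (\<forall>f. is_arg_max (agreement_prob n k \<epsilon>) (\<lambda>f. f \<in> antisymmetric_protocols n k) f \<longrightarrow>
        (\<exists>g. (\<forall>i \<in> {1..k}. f i = g) \<and> left_monotone_up_to_perm_flip n g))"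
  unfolding protocols_def antisymmetric_protocols_def
  by (intro conjI allI impI; erule maximizer_left_monotone[OF assms(3,4,1), rotated]) simp_all

end
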